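(* Let $E=\{e_1,\dots,e_n\}$ be a fixed orthonormal basis of $\mathbb{C}^n$ and let $M\neq 0$ be a hermitian $n\times n$ matrix with $\|M\|=\lambda_{\max}(M)=-\lambda_{\min}(M)$. Let $\mathbb{V}$ and $\mathbb{W}$ be the eigenspaces of $M$ for the eigenvalues $\|M\|$ and $-\|M\|$ respectively. Then the following statements are equivalent: (1) $(\mathbb{V},\mathbb{W})$ is a support; (2) $m_{\mathbb V}\cap m_{\mathbb W}\neq\emptyset$; (3) $M$ is a minimal matrix; (4) there exists a non-zero vector in the set $W(P_{\mathbb V}E_1P_{\mathbb V},\dots,P_{\mathbb V}E_nP_{\mathbb V})\cap W(P_{\mathbb W}E_1P_{\mathbb W},\dots,P_{\mathbb W}E_nP_{\mathbb W})$.
   Context: $\mathbb{C}^n$ has its usual inner product $\langle\cdot,\cdot\rangle$ (linear in the first variable); matrices are written in the basis $E$. For $x\in\mathbb{C}^n$ put $x_j=\langle x,e_j\rangle$ and $|x|^2=(|x_1|^2,\dots,|x_n|^2)$. For a subspace $S$, $P_S$ is the orthogonal projection onto $S$ and the moment of $S$ is $m_S=\operatorname{conv}\{|v|^2:v\in S,\ \|v\|=1\}\subset\mathbb{R}^n_{\ge0}$. A pair $(S,T)$ of subspaces is a support if $S\perp T$ and there exist orthonormal bases $\{s^h\}_{h=1}^r$ of $S$ and $\{w^j\}_{j=1}^k$ of $T$ and numbers $t_h,u_j\ge0$ with $\sum_h t_h=\sum_j u_j=1$ such that $\sum_{h=1}^r t_h|s^h|^2=\sum_{j=1}^k u_j|w^j|^2$.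 $E_i=e_i\otimes e_i$ is the orthogonal projection onto the span of $e_i$. For hermitian $A_1,\dots,A_m\in M_n(\mathbb{C})$ the joint numerical range is $W(A_1,\dots,A_m)=\{(\operatorname{tr}(A_1\rho),\dots,\operatorname{tr}(A_m\rho)):\rho\in M_n(\mathbb{C}),\ \rho=\rho^*,\ \rho\ge0,\ \operatorname{tr}(\rho)=1\}$. $\|\cdot\|$ on matrices is the spectral norm, and $\lambda_{\max}(M),\lambda_{\min}(M)$ are the largest and smallest eigenvalues. A hermitian matrix $M$ is minimal if $\|M\|\le\|M+D\|$ for every matrix $D$ that is diagonal in the basis $E$. *)

theory Defs
  imports "HOL-Analysis.Analysis"
begin

text \<open>
  Matrices of type \<open>complex^'n^'n\<close> act on \<open>complex^'n\<close> by \<open>(*v)\<close>, and \<open>'n\<close> also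
  indexes the orthonormal basis \<open>e\<close> of \<open>complex^'n\<close>.  The library's \<open>inner\<close> on
  \<open>complex^'n\<close> is the real inner product, i.e. the real part of \<open>cinner\<close>.  Its \<open>norm\<close> is
  the usual norm.  Complex subspaces and spans are \<open>vec.subspace\<close> and \<open>vec.span\<close>; the
  unqualified \<open>subspace\<close> and \<open>span\<close> are over the reals.
\<close>

definition cinner :: "complex^'n \<Rightarrow> complex^'n \<Rightarrow> complex" where
  "cinner x y = (\<Sum>i\<in>UNIV. x $ i * cnj (y $ i))"

definition is_onb :: "'i set \<Rightarrow> ('i \<Rightarrow> complex^'n) \<Rightarrow> (complex^'n) set \<Rightarrow> bool" where
  "is_onb I s S \<longleftrightarrow>
     (\<forall>i\<in>I. \<forall>j\<in>I. cinner (s i) (s j) = (if i = j then 1 else 0)) \<and> vec.span (s ` I) = S"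

definition hermitian :: "complex^'n^'n \<Rightarrow> bool" where
  "hermitian A \<longleftrightarrow> (\<forall>i j. A $ i $ j = cnj (A $ j $ i))"

definition pos_semidef :: "complex^'n^'n \<Rightarrow> bool" where
  "pos_semidef A \<longleftrightarrow> hermitian A \<and> (\<forall>v. 0 \<le> Re (cinner (A *v v) v))"

definition spectral_norm :: "complex^'n^'n \<Rightarrow> real" where
  "spectral_norm A = onorm ((*v) A)"

definition eigenvalue :: "complex^'n^'n \<Rightarrow> complex \<Rightarrow> bool" where
  "eigenvalue A c \<longleftrightarrow> (\<exists>v. v \<noteq> 0 \<and> A *v v = c *s v)"

definition eigenspace :: "complex^'n^'n \<Rightarrow> complex \<Rightarrow> (complex^'n) set" where
  "eigenspace A c = {v. A *v v = c *s v}"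

text \<open>Only meant for hermitian matrices, all of whose eigenvalues are real.\<close>

definition lambda_max :: "complex^'n^'n \<Rightarrow> real" where
  "lambda_max A = Max {r. eigenvalue A (complex_of_real r)}"

definition lambda_min :: "complex^'n^'n \<Rightarrow> real" where
  "lambda_min A = Min {r. eigenvalue A (complex_of_real r)}"

definition outer :: "complex^'n \<Rightarrow> complex^'n \<Rightarrow> complex^'n^'n" where
  "outer x y = (\<chi> i j. x $ i * cnj (y $ j))"

definition is_orth_proj :: "(complex^'n) set \<Rightarrow> complex^'n^'n \<Rightarrow> bool" where
  "is_orth_proj S P \<longleftrightarrow> (\<forall>v. P *v v \<in> S \<and> (\<forall>w\<in>S. cinner (v - P *v v) w = 0))"

definition orth_proj :: "(complex^'n) set \<Rightarrow> complex^'n^'n" where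
  "orth_proj S = (THE P. is_orth_proj S P)"

definition diagonal_in :: "('n \<Rightarrow> complex^'n) \<Rightarrow> complex^'n^'n \<Rightarrow> bool" where
  "diagonal_in e D \<longleftrightarrow> (\<forall>i j. i \<noteq> j \<longrightarrow> cinner (D *v e j) (e i) = 0)"

definition minimal_matrix :: "('n \<Rightarrow> complex^'n) \<Rightarrow> complex^'n^'n \<Rightarrow> bool" where
  "minimal_matrix e M \<longleftrightarrow>
     hermitian M \<and> (\<forall>D. diagonal_in e D \<longrightarrow> spectral_norm M \<le> spectral_norm (M + D))"

text \<open>The vector \<open>|x|\<^sup>2\<close> of squared moduli of the coordinates of \<open>x\<close> in the basis \<open>e\<close>.\<close>

definition sq_coords :: "('n \<Rightarrow> complex^'n) \<Rightarrow> complex^'n \<Rightarrow> real^'n" where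
  "sq_coords e x = (\<chi> j. (cmod (cinner x (e j)))\<^sup>2)"

definition moment :: "('n \<Rightarrow> complex^'n) \<Rightarrow> (complex^'n) set \<Rightarrow> (real^'n) set" where
  "moment e S = convex hull (sq_coords e ` {v \<in> S. norm v = 1})"

definition is_support ::
  "('n \<Rightarrow> complex^'n) \<Rightarrow> (complex^'n) set \<Rightarrow> (complex^'n) set \<Rightarrow> bool" where
  "is_support e S T \<longleftrightarrow>
     vec.subspace S \<and> vec.subspace T \<and>
     (\<forall>x\<in>S. \<forall>y\<in>T. cinner x y = 0) \<and>
     (\<exists>(r::nat) (k::nat) s w (t::nat \<Rightarrow> real) (u::nat \<Rightarrow> real).
        is_onb {1..r} s S \<and> is_onb {1..k} w T \<and>
        (\<forall>h\<in>{1..r}. 0 \<le> t h) \<and> (\<forall>j\<in>{1..k}. 0 \<le> u j) \<and>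
        (\<Sum>h=1..r. t h) = 1 \<and> (\<Sum>j=1..k. u j) = 1 \<and>
        (\<Sum>h=1..r. t h *\<^sub>R sq_coords e (s h)) = (\<Sum>j=1..k. u j *\<^sub>R sq_coords e (w j)))"

text \<open>
  The tuple of matrices is indexed by a finite type.  For hermitian matrices all the traces
  are real numbers; they are kept in \<open>complex\<close>, so that nothing is discarded.
\<close>

definition joint_numerical_range :: "('m \<Rightarrow> complex^'n^'n) \<Rightarrow> (complex^'m) set" where
  "joint_numerical_range A =
     {(\<chi> i. trace (A i ** \<rho>)) | \<rho>. pos_semidef \<rho> \<and> trace \<rho> = 1}"

lemma cinner_self: "cinner x x = complex_of_real ((norm x)\<^sup>2)"
  by (simp add: cinner_def norm_vec_def L2_set_def sum_nonneg complex_norm_square del: of_real_power)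

lemma inner_eq_Re_cinner: "x \<bullet> y = Re (cinner x y)"
  by (simp add: cinner_def inner_vec_def inner_complex_def Re_sum)

lemma orth_proj_decomp:
  assumes "vec.subspace S"
  shows "\<exists>p\<in>S. \<forall>w\<in>S. cinner (v - p) w = 0"
proof -
  have sub: "subspace S"
    using assms by (auto simp: subspace_def vec.subspace_def scaleR_vec_def
      vector_scalar_mult_def scaleR_conv_of_real)
  obtain p z where p: "p \<in> span S" and z: "\<And>w. w \<in> span S \<Longrightarrow> orthogonal z w" and v: "v = p + z"
    using orthogonal_subspace_decomp_exists[of S v] by metis
  have spS: "span S = S" using sub by (simp add: span_eq_iff)
  have "cinner z w = 0" if w: "w \<in> S" for w
  proof -
    have "\<i> *s w \<in> S" using assms w by (auto simp: vec.subspace_def)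
    then have "Re (cinner z w) = 0" "Re (cinner z (\<i> *s w)) = 0"
      using z w spS by (auto simp: orthogonal_def inner_eq_Re_cinner)
    moreover have "cinner z (\<i> *s w) = - \<i> * cinner z w"
      by (simp add: cinner_def sum_distrib_left mult_ac sum_negf)
    ultimately show ?thesis by (simp add: complex_eq_iff)
  qed
  then show ?thesis using p spS v by (intro bexI[of _ p]) auto
qed

lemma orth_proj_decomp_unique:
  assumes "vec.subspace S" "p \<in> S" "q \<in> S"
    "\<And>w. w \<in> S \<Longrightarrow> cinner (v - p) w = 0" "\<And>w. w \<in> S \<Longrightarrow> cinner (v - q) w = 0"
  shows "p = q"
proof -
  have "p - q \<in> S" using assms by (simp add: vec.subspace_diff)
  then have "cinner (v - p) (p - q) = 0" "cinner (v - q) (p - q) = 0" using assms by auto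
  moreover have "cinner (p - q) (p - q) = cinner (v - q) (p - q) - cinner (v - p) (p - q)"
    unfolding cinner_def sum_subtractf[symmetric] by (rule sum.cong) (simp_all add: algebra_simps)
  ultimately have "cinner (p - q) (p - q) = 0" by simp
  then show ?thesis by (simp add: cinner_self)
qed

lemma is_orth_proj_orth_proj:
  assumes S: "vec.subspace S"
  shows "is_orth_proj S (orth_proj S)"
proof -
  obtain p where p: "\<And>v. p v \<in> S" "\<And>v w. w \<in> S \<Longrightarrow> cinner (v - p v) w = 0"
    using orth_proj_decomp[OF S] by metis
  have "Vector_Spaces.linear (*s) (*s) p"
  proof (unfold_locales; (rule orth_proj_decomp_unique[OF S])?)
    fix a b w assume w: "w \<in> S"
    show "cinner (a + b - (p a + p b)) w = 0"
    proof -
      have "cinner (a + b - (p a + p b)) w = cinner (a - p a) w + cinner (b - p b) w"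
        by (simp add: cinner_def algebra_simps sum.distrib sum_subtractf)
      then show ?thesis using p w by simp
    qed
  next
    fix c b w assume w: "w \<in> S"
    have "cinner (c *s b - c *s p b) w = c * cinner (b - p b) w"
      by (simp add: cinner_def algebra_simps sum_distrib_left sum_subtractf)
    then show "cinner (c *s b - c *s p b) w = 0" using p w by simp
  qed (use p S in \<open>auto simp: vec.subspace_def\<close>)
  then have mp: "matrix p *v v = p v" for v by (rule matrix_works)
  have ex: "is_orth_proj S (matrix p)" by (simp add: is_orth_proj_def mp p)
  have "P = Q" if "is_orth_proj S P" "is_orth_proj S Q" for P Q
  proof -
    have "P *v v = Q *v v" for v
      by (rule orth_proj_decomp_unique[OF S, of _ _ v]) (use that in \<open>auto simp: is_orth_proj_def\<close>)
    then show ?thesis by (simp add: matrix_eq)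
  qed
  then have "\<exists>!P. is_orth_proj S P" using ex by blast
  then show ?thesis unfolding orth_proj_def by (rule theI')
qed

end

theory Submission
  imports Defs
begin

text \<open>
  The moment of a subspace \<open>S\<close> consists of the diagonals, in the basis \<open>e\<close>, of the density
  matrices with range in \<open>S\<close>; the spectral theorem on \<open>S\<close> turns such a matrix into a convex
  combination over an orthonormal basis of \<open>S\<close>.  Up to the scalar \<open>trace (P ** \<rho> ** P)\<close>,
  where \<open>P\<close> projects onto \<open>S\<close>, the joint numerical range consists of the same diagonals.
  Hence supports, common points of the moments and common nonzero points of the joint numerical
  ranges amount to the same thing.

  For minimality, write \<open>N = \<parallel>M\<parallel>\<close> and let \<open>d\<close> be the real part of the diagonal of \<open>D\<close>.  The
  quadratic form of \<open>M + D\<close> at a unit vector \<open>v\<close> is \<open>N + d \<bullet> |v|\<^sup>2\<close> on \<open>\<V>\<close> and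
  \<open>- N + d \<bullet> |v|\<^sup>2\<close> on \<open>\<W>\<close>.  A common point \<open>x\<close> of the moments therefore gives
  \<open>N + \<bar>d \<bullet> x\<bar> \<le> \<parallel>M + D\<parallel>\<close>.  If the moments are disjoint, a separating hyperplane provides a
  real diagonal \<open>D\<close> whose form is negative on \<open>\<V>\<close> and positive on \<open>\<W>\<close>, and by compactness of
  the unit sphere \<open>\<parallel>M + \<epsilon> D\<parallel> < N\<close> for small \<open>\<epsilon> > 0\<close>.
\<close>

subsection \<open>The hermitian inner product\<close>

lemma cinner_add_left: "cinner (x + y) z = cinner x z + cinner y z"
  by (simp add: cinner_def algebra_simps sum.distrib)

lemma cinner_diff_left: "cinner (x - y) z = cinner x z - cinner y z"
  by (simp add: cinner_def algebra_simps sum_subtractf)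

lemma cinner_scale_left: "cinner (c *s x) z = c * cinner x z"
  by (simp add: cinner_def sum_distrib_left mult_ac)

lemma cinner_zero_left [simp]: "cinner 0 z = 0"
  by (simp add: cinner_def)

lemma cinner_sum_left: "cinner (\<Sum>i\<in>I. f i) z = (\<Sum>i\<in>I. cinner (f i) z)"
  by (induction I rule: infinite_finite_induct) (simp_all add: cinner_add_left)

lemma cinner_commute: "cinner y x = cnj (cinner x y)"
  by (simp add: cinner_def mult_ac)

lemma cinner_scale_right: "cinner x (c *s z) = cnj c * cinner x z"
  by (simp add: cinner_def sum_distrib_left mult_ac)

lemma cinner_zero_right [simp]: "cinner z 0 = 0"
  by (simp add: cinner_def)

lemma cinner_add_right: "cinner z (x + y) = cinner z x + cinner z y"
  by (simp add: cinner_def algebra_simps sum.distrib)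

lemma cinner_sum_right: "cinner z (\<Sum>i\<in>I. f i) = (\<Sum>i\<in>I. cinner z (f i))"
  by (induction I rule: infinite_finite_induct) (simp_all add: cinner_add_right)

lemma cinner_mult_commute: "cinner x y * cinner y x = complex_of_real ((cmod (cinner x y))\<^sup>2)"
  by (metis cinner_commute complex_norm_square)

lemma cinner_self_eq_0: "cinner x x = 0 \<longleftrightarrow> x = 0"
  by (simp add: cinner_self)

lemma cinner_self_eq_1: "cinner x x = 1 \<longleftrightarrow> norm x = 1"
proof -
  have "cinner x x = 1 \<longleftrightarrow> (norm x)\<^sup>2 = 1"
    unfolding cinner_self by (metis of_real_1 of_real_eq_iff)
  then show ?thesis by (simp add: power2_eq_1_iff) (use norm_ge_zero[of x] in linarith)
qed

lemma hermitian_cinner: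
  assumes "hermitian A"
  shows "cinner (A *v x) y = cinner x (A *v y)"
proof -
  have "cinner (A *v x) y = (\<Sum>i\<in>UNIV. \<Sum>j\<in>UNIV. A $ i $ j * x $ j * cnj (y $ i))"
    by (simp add: cinner_def matrix_vector_mult_def sum_distrib_right)
  also have "\<dots> = (\<Sum>j\<in>UNIV. \<Sum>i\<in>UNIV. A $ i $ j * x $ j * cnj (y $ i))"
    by (rule sum.swap)
  also have "\<dots> = cinner x (A *v y)"
    unfolding cinner_def matrix_vector_mult_def
  proof (simp add: sum_distrib_left, intro sum.cong refl)
    fix i j
    have "A $ j $ i = cnj (A $ i $ j)" using assms unfolding hermitian_def by blast
    then show "A $ j $ i * x $ i * cnj (y $ j) = x $ i * (cnj (A $ i $ j) * cnj (y $ j))"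
      by (simp only: mult_ac)
  qed
  finally show ?thesis .
qed

lemma hermitian_inner:
  assumes "hermitian A"
  shows "(A *v x) \<bullet> y = x \<bullet> (A *v y)"
  by (simp add: inner_eq_Re_cinner hermitian_cinner[OF assms])

lemma hermitian_add: "hermitian A \<Longrightarrow> hermitian B \<Longrightarrow> hermitian (A + B)"
  unfolding hermitian_def vector_add_component complex_cnj_add by metis

lemma hermitian_scaleR: "hermitian A \<Longrightarrow> hermitian (c *\<^sub>R A)"
  unfolding hermitian_def by (metis complex_cnj_scaleR vector_scaleR_component)

text \<open>Bridge between the real vector space structure, where norms, compactness and
  \<open>dim\<close> live, and the complex one used for eigenvectors.\<close>

lemma scaleR_eq_smult: "c *\<^sub>R (x::complex^'n) = complex_of_real c *s x"
  by (simp add: vec_eq_iff scaleR_conv_of_real[where 'a = complex])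

lemma matrix_vector_mult_scaleR_complex:
  "(A :: complex^'n^'n) *v (c *\<^sub>R x) = c *\<^sub>R (A *v x)"
  by (rule linear_scale[OF matrix_vector_mul_linear])

lemma vec_subspace_imp_subspace: "vec.subspace (S :: (complex^'n) set) \<Longrightarrow> subspace S"
  by (simp add: subspace_def vec.subspace_def scaleR_eq_smult)

section \<open>Orthonormal bases: expansion and Parseval's identity\<close>

lemma is_onb_mem: "is_onb I s S \<Longrightarrow> i \<in> I \<Longrightarrow> s i \<in> S"
  by (auto simp: is_onb_def intro: vec.span_base)

lemma is_onb_norm: "is_onb I s S \<Longrightarrow> i \<in> I \<Longrightarrow> norm (s i) = 1"
  by (simp add: is_onb_def flip: cinner_self_eq_1)

lemma cinner_span_eq_0:
  assumes "\<And>y. y \<in> B \<Longrightarrow> cinner x y = 0" and "z \<in> vec.span B"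
  shows "cinner x z = 0"
  using assms(2)
proof (induction rule: vec.span_induct)
  case base
  show ?case by (simp add: vec.subspace_def cinner_add_right cinner_scale_right)
qed (use assms(1) in auto)

text \<open>The residual \<open>y\<close> lies in \<open>S\<close> and is orthogonal to every
  \<open>s k\<close>, hence to all of \<open>S\<close>, hence to itself.\<close>

lemma is_onb_expansion:
  assumes s: "is_onb I s S" and I: "finite I" and x: "x \<in> S"
  shows "x = (\<Sum>i\<in>I. cinner x (s i) *s s i)"
proof -
  define y where "y = x - (\<Sum>i\<in>I. cinner x (s i) *s s i)"
  have S: "vec.subspace S" using s by (auto simp: is_onb_def)
  have "y \<in> S"
    unfolding y_def
    by (intro vec.subspace_diff[OF S] x vec.subspace_sum[OF S] vec.subspace_scale[OF S])
      (rule is_onb_mem[OF s])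
  have "cinner y z = 0" if z: "z \<in> s ` I" for z
  proof -
    obtain k where k: "k \<in> I" "z = s k" using z by blast
    have "(\<Sum>i\<in>I. cinner x (s i) * cinner (s i) (s k))
        = (\<Sum>i\<in>I. if i = k then cinner x (s i) else 0)"
      using s k by (intro sum.cong) (auto simp: is_onb_def)
    then show ?thesis
      using k I by (simp add: y_def cinner_diff_left cinner_sum_left cinner_scale_left)
  qed
  then have "cinner y y = 0"
    using \<open>y \<in> S\<close> s cinner_span_eq_0 unfolding is_onb_def by metis
  then show ?thesis by (simp add: cinner_self_eq_0 y_def)
qed

lemma is_onb_cinner_expansion:
  assumes "is_onb I s S" "finite I" "x \<in> S"
  shows "cinner x y = (\<Sum>i\<in>I. cinner x (s i) * cinner (s i) y)"
  by (subst is_onb_expansion[OF assms]) (simp add: cinner_sum_left cinner_scale_left)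

lemma is_onb_norm_expansion:
  assumes "is_onb I s S" "finite I" "x \<in> S"
  shows "(norm x)\<^sup>2 = (\<Sum>i\<in>I. (cmod (cinner x (s i)))\<^sup>2)"
proof -
  have "complex_of_real ((norm x)\<^sup>2) = (\<Sum>i\<in>I. complex_of_real ((cmod (cinner x (s i)))\<^sup>2))"
    using is_onb_cinner_expansion[OF assms, of x]
    unfolding cinner_self[symmetric] cinner_mult_commute .
  then show ?thesis by (metis of_real_eq_iff of_real_sum)
qed

subsection \<open>The spectral theorem on an invariant subspace\<close>

lemma compact_unit_sphere_subspace:
  assumes "vec.subspace (S :: (complex^'n) set)"
  shows "compact {v \<in> S. norm v = 1}"
proof -
  have "{v \<in> S. norm v = 1} = S \<inter> sphere 0 1" by auto
  moreover have "closed S" using closed_subspace vec_subspace_imp_subspace assms by blast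
  ultimately show ?thesis by (simp add: closed_Int_compact)
qed

text \<open>A maximizer \<open>v\<close> of the quadratic form is an eigenvector: with \<open>B = \<mu> - A\<close>, the form of
  \<open>B\<close> is nonnegative on \<open>S\<close> and vanishes at \<open>v\<close>, so its derivative at \<open>v\<close> along \<open>B v\<close> is zero.\<close>

lemma hermitian_eigenvector_exists:
  fixes A :: "complex^'n^'n"
  assumes S: "vec.subspace S" and A: "hermitian A"
    and inv: "\<And>x. x \<in> S \<Longrightarrow> A *v x \<in> S" and "x0 \<in> S" "x0 \<noteq> 0"
  shows "\<exists>v\<in>S. \<exists>\<mu>. norm v = 1 \<and> A *v v = complex_of_real \<mu> *s v"
proof -
  let ?K = "{v \<in> S. norm v = 1}"
  have sub: "subspace S" using S vec_subspace_imp_subspace by blast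
  have "(1 / norm x0) *\<^sub>R x0 \<in> ?K" using assms sub by (simp add: subspace_scale)
  then have ne: "?K \<noteq> {}" by blast
  have "continuous_on ?K (\<lambda>v. (A *v v) \<bullet> v)" by (intro continuous_intros)
  then obtain v where v: "v \<in> ?K" and max: "\<And>y. y \<in> ?K \<Longrightarrow> (A *v y) \<bullet> y \<le> (A *v v) \<bullet> v"
    using continuous_attains_sup[OF compact_unit_sphere_subspace[OF S] ne] by blast
  define \<mu> where "\<mu> = (A *v v) \<bullet> v"
  define B where "B y = \<mu> *\<^sub>R y - A *v y" for y
  have vv: "v \<bullet> v = 1" using v by (simp add: dot_square_norm)
  have pos: "0 \<le> B y \<bullet> y" if y: "y \<in> S" for y
  proof (cases "y = 0")
    case False
    let ?y = "(1 / norm y) *\<^sub>R y"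
    have "?y \<in> ?K" using y False sub by (simp add: subspace_scale)
    then have "(A *v ?y) \<bullet> ?y \<le> \<mu>" unfolding \<mu>_def by (rule max)
    then have "(A *v y) \<bullet> y / (norm y)\<^sup>2 \<le> \<mu>"
      by (simp add: matrix_vector_mult_scaleR_complex power2_eq_square)
    then show ?thesis
      using False by (simp add: B_def inner_diff_left dot_square_norm field_simps)
  qed (simp add: B_def)
  define w where "w = B v"
  have w: "w \<in> S" using v sub inv by (auto simp: w_def B_def intro: subspace_diff subspace_scale)
  have Bv: "B v \<bullet> v = 0" by (simp add: B_def inner_diff_left \<mu>_def vv)
  have "B x \<bullet> y = x \<bullet> B y" for x y
    by (simp add: B_def inner_diff_left inner_diff_right hermitian_inner[OF A])
  then have sym: "B w \<bullet> v = w \<bullet> w" by (simp add: w_def)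
  have quad: "0 \<le> 2 * t * (w \<bullet> w) + t\<^sup>2 * (B w \<bullet> w)" for t
  proof -
    have "B (v + t *\<^sub>R w) = w + t *\<^sub>R B w"
      by (simp add: w_def B_def algebra_simps matrix_vector_mult_scaleR_complex)
    moreover have "0 \<le> B (v + t *\<^sub>R w) \<bullet> (v + t *\<^sub>R w)"
      using v w sub by (intro pos subspace_add subspace_scale) auto
    ultimately show ?thesis
      using sym Bv by (simp add: w_def[symmetric] inner_add_left inner_add_right power2_eq_square
            algebra_simps)
  qed
  have "w \<bullet> w \<le> 0"
  proof -
    define b where "b = B w \<bullet> w"
    have b: "0 \<le> b" using pos[OF w] by (simp add: b_def)
    show ?thesis
    proof (rule ccontr)
      assume "\<not> w \<bullet> w \<le> 0"
      then have q: "0 < w \<bullet> w" by linarith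
      \<comment> \<open>Evaluating \<open>quad\<close> at \<open>- r\<close> and dividing by
        \<open>r\<close> leaves \<open>r * b - 2 * (w \<bullet> w)\<close>. This \<open>r\<close>
        makes the first term at most \<open>w \<bullet> w\<close>, so the negative term wins; the
        summand 1 keeps the denominator positive when \<open>b = 0\<close>.\<close>
      define r where "r = (w \<bullet> w) / (1 + b)"
      have r: "0 < r" "r * b \<le> w \<bullet> w" using q b by (auto simp: r_def field_simps)
      have "0 \<le> r * (r * b - 2 * (w \<bullet> w))"
        using quad[of "- r"] by (simp add: b_def power2_eq_square algebra_simps)
      then have "0 \<le> r * b - 2 * (w \<bullet> w)" using r by (simp add: zero_le_mult_iff)
      then show False using r q by simp
    qed
  qed
  then have "w \<bullet> w = 0" using inner_ge_zero[of w] by linarith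
  then have "w = 0" by simp
  then have "A *v v = complex_of_real \<mu> *s v" by (simp add: w_def B_def scaleR_eq_smult)
  then show ?thesis using v by blast
qed

text \<open>Induction on the real dimension of \<open>S\<close>, a decreasing measure. An
  eigenvector \<open>v\<close> is split off; its orthogonal complement \<open>S'\<close> in
  \<open>S\<close> is again invariant, because \<open>A\<close> is hermitian and \<open>v\<close> is
  an eigenvector.\<close>

lemma hermitian_spectral:
  fixes A :: "complex^'n^'n"
  assumes "vec.subspace S" and A: "hermitian A" and "\<And>x. x \<in> S \<Longrightarrow> A *v x \<in> S"
  shows "\<exists>(r::nat) s t. is_onb {1..r} s S \<and>
    (\<forall>h\<in>{1..r}. A *v s h = complex_of_real (t h) *s s h)"
  using assms(1,3)
proof (induction "dim S" arbitrary: S rule: less_induct)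
  case less
  note S = less.prems(1) and inv = less.prems(2)
  show ?case
  proof (cases "S = {0}")
    case True
    \<comment> \<open>The zero subspace has the empty basis, so the family is a dummy.\<close>
    then have "is_onb {1..0::nat} (\<lambda>_. 0) S" by (simp add: is_onb_def)
    then show ?thesis by (intro exI[of _ 0]) auto
  next
    case False
    then obtain x0 where "x0 \<in> S" "x0 \<noteq> 0" using vec.subspace_0[OF S] by blast
    then obtain v \<mu> where v: "v \<in> S" "norm v = 1" "A *v v = complex_of_real \<mu> *s v"
      using hermitian_eigenvector_exists[OF S A inv] by blast
    define S' where "S' = {x \<in> S. cinner x v = 0}"
    have S': "vec.subspace S'"
      using S by (auto simp: S'_def vec.subspace_def cinner_add_left cinner_scale_left)
    have inv': "A *v x \<in> S'" if "x \<in> S'" for x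
      using that inv v by (simp add: S'_def hermitian_cinner[OF A] cinner_scale_right)
    have vv: "cinner v v = 1" using v(2) by (simp add: cinner_self_eq_1)
    have "v \<notin> S'" by (simp add: S'_def vv)
    then have "S' \<subset> S" using v by (auto simp: S'_def)
    then have "dim S' < dim S"
      using S S' vec_subspace_imp_subspace by (metis dim_psubset span_eq_iff)
    then obtain r s t where s: "is_onb {1..r::nat} s S'"
      and t: "\<forall>h\<in>{1..r}. A *v s h = complex_of_real (t h) *s s h"
      using less.hyps[OF _ S' inv'] by blast
    define s' where "s' = s(Suc r := v)"
    have im: "s' ` {1..Suc r} = insert v (s ` {1..r})"
      by (auto simp: s'_def atLeastAtMostSuc_conv)
    have orth: "cinner (s h) v = 0" "cinner v (s h) = 0" if "h \<in> {1..r}" for h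
      using is_onb_mem[OF s that] cinner_commute[of "s h" v] by (auto simp: S'_def)
    have "cinner (s' i) (s' j) = (if i = j then 1 else 0)"
      if "i \<in> {1..Suc r}" "j \<in> {1..Suc r}" for i j
      using that s orth vv by (auto simp: s'_def is_onb_def atLeastAtMostSuc_conv)
    moreover have "vec.span (insert v (s ` {1..r})) = S"
    proof
      have "s ` {1..r} \<subseteq> S" using is_onb_mem[OF s] by (auto simp: S'_def)
      then show "vec.span (insert v (s ` {1..r})) \<subseteq> S"
        using v(1) S by (intro vec.span_minimal) auto
      show "S \<subseteq> vec.span (insert v (s ` {1..r}))"
      proof
        fix x assume x: "x \<in> S"
        have "x - cinner x v *s v \<in> S'"
          using x v(1) S vv
          by (simp add: S'_def vec.subspace_diff vec.subspace_scale cinner_diff_left cinner_scale_left)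
        then show "x \<in> vec.span (insert v (s ` {1..r}))"
          using s unfolding is_onb_def vec.span_breakdown_eq by blast
      qed
    qed
    ultimately have "is_onb {1..Suc r} s' S" unfolding is_onb_def im by blast
    moreover have "\<forall>h\<in>{1..Suc r}. A *v s' h = complex_of_real ((t(Suc r := \<mu>)) h) *s s' h"
      using t v(3) by (auto simp: s'_def atLeastAtMostSuc_conv)
    ultimately show ?thesis by blast
  qed
qed

subsection \<open>Moments as diagonals of density matrices\<close>

lemma cinner_axis: "cinner x (axis k 1) = x $ k"
proof -
  have "cinner x (axis k 1) = (\<Sum>i\<in>UNIV. if i = k then x $ i else 0)"
    unfolding cinner_def by (rule sum.cong) (auto simp: axis_def)
  then show ?thesis by simp
qed

lemma norm_axis_1: "norm (axis k 1 :: complex^'n) = 1"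
  unfolding cinner_self_eq_1[symmetric] cinner_axis by (simp add: axis_def)

lemma matrix_entry_cinner: "A $ i $ j = cinner (A *v axis j 1) (axis i 1)"
  unfolding cinner_axis by (simp add: matrix_vector_mult_def axis_def if_distrib cong: if_cong)

lemma hermitianI:
  assumes "\<And>x y. cinner (A *v x) y = cinner x (A *v y)"
  shows "hermitian A"
  unfolding hermitian_def matrix_entry_cinner by (metis assms cinner_commute)

lemma outer_mult_vector: "outer x y *v v = cinner v y *s x"
  by (simp add: vec_eq_iff outer_def matrix_vector_mult_def cinner_def sum_distrib_right
      sum_distrib_left mult_ac)

lemma trace_outer: "trace (outer x y) = cinner x y"
  by (simp add: trace_def outer_def cinner_def)

lemma matrix_mult_outer: "A ** outer x y = outer (A *v x) y"
  by (simp add: vec_eq_iff outer_def matrix_vector_mult_def matrix_matrix_mult_def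
      sum_distrib_left sum_distrib_right mult_ac)

lemma scaleR_matrix_vector_mult: "(c *\<^sub>R A) *v x = c *\<^sub>R (A *v (x :: complex^'n))"
  by (simp add: vec_eq_iff matrix_vector_mult_def scaleR_sum_right)

lemma hermitian_outer: "hermitian (outer x x)"
  by (rule hermitianI)
    (simp add: outer_mult_vector cinner_scale_left cinner_scale_right cinner_commute[symmetric])

lemma pos_semidef_outer: "pos_semidef (outer x x)"
  unfolding pos_semidef_def
proof (intro conjI allI hermitian_outer)
  show "0 \<le> Re (cinner (outer x x *v v) v)" for v
    by (simp add: outer_mult_vector cinner_scale_left cinner_mult_commute)
qed

lemma pos_semidef_convex_comb:
  assumes "pos_semidef A" "pos_semidef B" "0 \<le> u" "0 \<le> v"
  shows "pos_semidef (u *\<^sub>R A + v *\<^sub>R B)"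
  using assms
  by (simp add: pos_semidef_def hermitian_add hermitian_scaleR matrix_vector_mult_add_rdistrib
      scaleR_matrix_vector_mult flip: inner_eq_Re_cinner) (simp add: inner_add_left)

lemma trace_scaleR: "trace (c *\<^sub>R A) = c *\<^sub>R trace A"
  by (simp add: trace_def scaleR_sum_right)

text \<open>The set \<open>C\<close> of diagonals of density matrices with range in \<open>S\<close>
  is convex, and it contains the generators of the moment because \<open>outer v v\<close> has
  diagonal \<open>sq_coords e v\<close>. So it contains their convex hull.\<close>

lemma moment_imp_density:
  fixes e :: "'n::finite \<Rightarrow> complex^'n"
  assumes S: "vec.subspace S" and x: "x \<in> moment e S"
  shows "\<exists>\<rho>. pos_semidef \<rho> \<and> trace \<rho> = 1 \<and> (\<forall>v. \<rho> *v v \<in> S) \<and>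
    (\<forall>i. cinner (\<rho> *v e i) (e i) = complex_of_real (x $ i))"
proof -
  define C where "C = {x :: real^'n. \<exists>\<rho>. pos_semidef \<rho> \<and> trace \<rho> = 1 \<and> (\<forall>v. \<rho> *v v \<in> S) \<and>
    (\<forall>i. cinner (\<rho> *v e i) (e i) = complex_of_real (x $ i))}"
  have sub: "subspace S" using S by (rule vec_subspace_imp_subspace)
  have "sq_coords e v \<in> C" if v: "v \<in> S" "norm v = 1" for v
    unfolding C_def
  proof (intro CollectI exI[of _ "outer v v"] conjI allI)
    show "outer v v *v z \<in> S" for z
      using v(1) S by (simp add: outer_mult_vector vec.subspace_scale)
    show "cinner (outer v v *v e i) (e i) = complex_of_real (sq_coords e v $ i)" for i
      using cinner_mult_commute[of "e i" v] cinner_mult_commute[of v "e i"]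
      by (simp add: outer_mult_vector cinner_scale_left sq_coords_def mult.commute)
  qed (use v(2) in \<open>simp_all add: pos_semidef_outer trace_outer cinner_self_eq_1\<close>)
  moreover have "convex C"
  proof (rule convexI)
    fix x y :: "real^'n" and u v :: real
    assume "x \<in> C" "y \<in> C" and uv: "0 \<le> u" "0 \<le> v" "u + v = 1"
    then obtain \<rho> \<sigma> where
      \<rho>: "pos_semidef \<rho>" "trace \<rho> = 1" "\<And>v. \<rho> *v v \<in> S"
        "\<And>i. cinner (\<rho> *v e i) (e i) = complex_of_real (x $ i)" and
      \<sigma>: "pos_semidef \<sigma>" "trace \<sigma> = 1" "\<And>v. \<sigma> *v v \<in> S"
        "\<And>i. cinner (\<sigma> *v e i) (e i) = complex_of_real (y $ i)"
      unfolding C_def by blast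
    have "trace (u *\<^sub>R \<rho> + v *\<^sub>R \<sigma>) = 1"
      using \<rho>(2) \<sigma>(2) uv(3) by (simp add: trace_add trace_scaleR flip: of_real_add scaleR_add_left)
    moreover have "(u *\<^sub>R \<rho> + v *\<^sub>R \<sigma>) *v z \<in> S" for z
      using \<rho>(3) \<sigma>(3) sub
      by (simp add: matrix_vector_mult_add_rdistrib scaleR_matrix_vector_mult subspace_add
          subspace_scale)
    moreover have "cinner ((u *\<^sub>R \<rho> + v *\<^sub>R \<sigma>) *v e i) (e i) = complex_of_real ((u *\<^sub>R x + v *\<^sub>R y) $ i)"
      for i
      using \<rho>(4) \<sigma>(4)
      by (simp add: matrix_vector_mult_add_rdistrib scaleR_matrix_vector_mult cinner_add_left
          scaleR_eq_smult cinner_scale_left)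
    ultimately show "u *\<^sub>R x + v *\<^sub>R y \<in> C"
      unfolding C_def using pos_semidef_convex_comb[OF \<rho>(1) \<sigma>(1) uv(1,2)] by blast
  qed
  ultimately have "moment e S \<subseteq> C"
    unfolding moment_def by (intro hull_minimal) auto
  then show ?thesis using x unfolding C_def by blast
qed

text \<open>As the range of \<open>A\<close> lies in \<open>S\<close>, diagonalizing
  \<open>A\<close> on \<open>S\<close> alone determines its whole quadratic form: expand
  \<open>A *v v\<close> in the eigenbasis and move \<open>A\<close> across the inner product. The
  weights \<open>t h\<close> are the eigenvalues of \<open>A\<close> on \<open>S\<close>.\<close>

lemma pos_semidef_spectral:
  assumes S: "vec.subspace S" and A: "pos_semidef A" and ran: "\<And>v. A *v v \<in> S"
  shows "\<exists>(r::nat) s t. is_onb {1..r} s S \<and> (\<forall>h\<in>{1..r}. 0 \<le> t h) \<and>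
    trace A = complex_of_real (\<Sum>h=1..r. t h) \<and>
    (\<forall>i. cinner (A *v e i) (e i) =
      complex_of_real ((\<Sum>h=1..r. t h *\<^sub>R sq_coords e (s h)) $ i))"
proof -
  have herm: "hermitian A" using A by (simp add: pos_semidef_def)
  obtain r :: nat and s t where s: "is_onb {1..r} s S"
    and t: "\<And>h. h \<in> {1..r} \<Longrightarrow> A *v s h = complex_of_real (t h) *s s h"
    using hermitian_spectral[OF S herm] ran by blast
  have quad: "cinner (A *v v) v = complex_of_real (\<Sum>h=1..r. t h * (cmod (cinner (s h) v))\<^sup>2)" for v
  proof -
    have "cinner (A *v v) v = (\<Sum>h=1..r. cinner (A *v v) (s h) * cinner (s h) v)"
      by (rule is_onb_cinner_expansion[OF s finite_atLeastAtMost ran])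
    also have "\<dots> = (\<Sum>h=1..r. complex_of_real (t h * (cmod (cinner (s h) v))\<^sup>2))"
    proof (rule sum.cong[OF refl])
      fix h assume h: "h \<in> {1..r}"
      have "cinner (A *v v) (s h) = complex_of_real (t h) * cinner v (s h)"
        by (simp add: hermitian_cinner[OF herm] t[OF h] cinner_scale_right)
      then show "cinner (A *v v) (s h) * cinner (s h) v
          = complex_of_real (t h * (cmod (cinner (s h) v))\<^sup>2)"
        using cinner_mult_commute[of "s h" v] by (simp add: mult_ac)
    qed
    finally show ?thesis by simp
  qed
  have nonneg: "0 \<le> t h" if h: "h \<in> {1..r}" for h
  proof -
    have "cinner (s h) (s h) = 1" using s h by (simp add: is_onb_def)
    then have "cinner (A *v s h) (s h) = complex_of_real (t h)"
      by (simp add: t[OF h] cinner_scale_left)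
    then show ?thesis using A unfolding pos_semidef_def by (metis Re_complex_of_real)
  qed
  \<comment> \<open>The trace is summed in the standard basis, where the squared moduli of the
    entries of each unit vector \<open>s h\<close> add up to 1.\<close>
  have "trace A = (\<Sum>k\<in>UNIV. cinner (A *v axis k 1) (axis k 1))"
    by (simp add: trace_def matrix_entry_cinner)
  also have "\<dots> = complex_of_real (\<Sum>k\<in>UNIV. \<Sum>h=1..r. t h * (cmod (s h $ k))\<^sup>2)"
    unfolding quad by (simp only: cinner_axis of_real_sum)
  also have "(\<Sum>k\<in>UNIV. \<Sum>h=1..r. t h * (cmod (s h $ k))\<^sup>2)
      = (\<Sum>h=1..r. t h * (\<Sum>k\<in>UNIV. (cmod (s h $ k))\<^sup>2))"
    by (subst sum.swap) (simp add: sum_distrib_left)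
  also have "\<dots> = (\<Sum>h=1..r. t h)"
  proof (rule sum.cong[OF refl])
    fix h assume "h \<in> {1..r}"
    then have "norm (s h) = 1" by (rule is_onb_norm[OF s])
    then show "t h * (\<Sum>k\<in>UNIV. (cmod (s h $ k))\<^sup>2) = t h"
      by (simp add: norm_vec_def L2_set_def)
  qed
  finally have "trace A = complex_of_real (\<Sum>h=1..r. t h)" .
  then show ?thesis
    using s nonneg by (intro exI[of _ r] exI[of _ s] exI[of _ t]) (simp add: quad sq_coords_def)
qed

lemma onb_sum_in_moment:
  assumes "is_onb {1..r::nat} s S" and "\<forall>h\<in>{1..r}. 0 \<le> t h" and "(\<Sum>h=1..r. t h) = 1"
  shows "(\<Sum>h=1..r. t h *\<^sub>R sq_coords e (s h)) \<in> moment e S"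
  unfolding moment_def
proof (rule convex_sum)
  show "sq_coords e (s h) \<in> convex hull (sq_coords e ` {v \<in> S. norm v = 1})" if "h \<in> {1..r}" for h
    using is_onb_mem[OF assms(1) that] is_onb_norm[OF assms(1) that] by (intro hull_inc) auto
qed (use assms in auto)

text \<open>A point of the hull may mix unit vectors that are not orthogonal. Passing to a density
  matrix with the same diagonal and diagonalizing it replaces them by a single orthonormal
  basis.\<close>

lemma moment_imp_onb_sum:
  assumes S: "vec.subspace S" and x: "x \<in> moment e S"
  shows "\<exists>(r::nat) s t. is_onb {1..r} s S \<and> (\<forall>h\<in>{1..r}. 0 \<le> t h) \<and> (\<Sum>h=1..r. t h) = 1 \<and>
    x = (\<Sum>h=1..r. t h *\<^sub>R sq_coords e (s h))"
proof -
  obtain \<rho> where \<rho>: "pos_semidef \<rho>" "trace \<rho> = 1" "\<And>v. \<rho> *v v \<in> S"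
      "\<And>i. cinner (\<rho> *v e i) (e i) = complex_of_real (x $ i)"
    using moment_imp_density[OF S x] by blast
  obtain r :: nat and s t where s: "is_onb {1..r} s S" "\<forall>h\<in>{1..r}. 0 \<le> t h"
    and tr: "trace \<rho> = complex_of_real (\<Sum>h=1..r. t h)"
    and diag: "\<And>i. cinner (\<rho> *v e i) (e i) =
      complex_of_real ((\<Sum>h=1..r. t h *\<^sub>R sq_coords e (s h)) $ i)"
    using pos_semidef_spectral[OF S \<rho>(1) \<rho>(3), of e] by blast
  have "(\<Sum>h=1..r. t h) = 1" using tr \<rho>(2) by (metis of_real_1 of_real_eq_iff)
  moreover have "x = (\<Sum>h=1..r. t h *\<^sub>R sq_coords e (s h))"
    unfolding vec_eq_iff using diag \<rho>(4) by (metis of_real_eq_iff)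
  ultimately show ?thesis using s by blast
qed

lemma is_support_iff_moments_meet:
  assumes "vec.subspace S" "vec.subspace T" "\<forall>x\<in>S. \<forall>y\<in>T. cinner x y = 0"
  shows "is_support e S T \<longleftrightarrow> moment e S \<inter> moment e T \<noteq> {}"
proof
  assume "is_support e S T"
  then obtain r k :: nat and s w t u where "is_onb {1..r} s S" "is_onb {1..k} w T"
      "\<forall>h\<in>{1..r}. 0 \<le> t h" "\<forall>j\<in>{1..k}. 0 \<le> u j" "(\<Sum>h=1..r. t h) = 1" "(\<Sum>j=1..k. u j) = 1"
      and eq: "(\<Sum>h=1..r. t h *\<^sub>R sq_coords e (s h)) = (\<Sum>j=1..k. u j *\<^sub>R sq_coords e (w j))"
    unfolding is_support_def by blast
  then have "(\<Sum>h=1..r. t h *\<^sub>R sq_coords e (s h)) \<in> moment e S"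
      "(\<Sum>j=1..k. u j *\<^sub>R sq_coords e (w j)) \<in> moment e T"
    by (blast intro: onb_sum_in_moment)+
  then show "moment e S \<inter> moment e T \<noteq> {}" using eq by auto
next
  assume "moment e S \<inter> moment e T \<noteq> {}"
  then obtain x where x: "x \<in> moment e S" "x \<in> moment e T" by blast
  obtain r :: nat and s t where 1: "is_onb {1..r} s S" "\<forall>h\<in>{1..r}. 0 \<le> t h"
      "(\<Sum>h=1..r. t h) = 1" "x = (\<Sum>h=1..r. t h *\<^sub>R sq_coords e (s h))"
    using moment_imp_onb_sum[OF assms(1) x(1)] by blast
  obtain k :: nat and w u where 2: "is_onb {1..k} w T" "\<forall>j\<in>{1..k}. 0 \<le> u j"
      "(\<Sum>j=1..k. u j) = 1" "x = (\<Sum>j=1..k. u j *\<^sub>R sq_coords e (w j))"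
    using moment_imp_onb_sum[OF assms(2) x(2)] by blast
  show "is_support e S T"
    unfolding is_support_def
    by (intro conjI assms exI[of _ r] exI[of _ k] exI[of _ s] exI[of _ w] exI[of _ t] exI[of _ u]
        1(1-3) 2(1-3)) (use 1(4) 2(4) in simp)
qed

lemma sum_sq_coords:
  assumes "is_onb UNIV e UNIV"
  shows "(\<Sum>i\<in>UNIV. sq_coords e v $ i) = (norm v)\<^sup>2"
  using is_onb_norm_expansion[OF assms, of v] by (simp add: sq_coords_def)

text \<open>The hyperplane \<open>?H\<close> is convex and contains the generators by Parseval. It
  keeps moment points away from 0 and fixes the scale when proportional ones are compared.\<close>

lemma sum_moment_eq_1:
  assumes e: "is_onb UNIV e UNIV" and x: "x \<in> moment e S"
  shows "(\<Sum>i\<in>UNIV. x $ i) = 1"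
proof -
  let ?H = "{x :: real^'n. (\<Sum>i\<in>UNIV. x $ i) = 1}"
  have "convex ?H"
    by (rule convexI) (simp add: sum.distrib flip: sum_distrib_left)
  then have "moment e S \<subseteq> ?H"
    unfolding moment_def by (intro hull_minimal) (auto simp: sum_sq_coords[OF e])
  then show ?thesis using x by blast
qed

subsection \<open>The joint numerical range of compressed coordinate projections\<close>

lemma orth_proj_mem: "vec.subspace S \<Longrightarrow> orth_proj S *v v \<in> S"
  using is_orth_proj_orth_proj by (auto simp: is_orth_proj_def)

lemma orth_proj_orthogonal:
  "vec.subspace S \<Longrightarrow> w \<in> S \<Longrightarrow> cinner (orth_proj S *v v) w = cinner v w"
  using is_orth_proj_orth_proj[of S] unfolding is_orth_proj_def cinner_diff_left
  by (metis eq_iff_diff_eq_0)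

lemma hermitian_orth_proj:
  assumes "vec.subspace S"
  shows "hermitian (orth_proj S)"
proof (rule hermitianI)
  let ?P = "orth_proj S"
  fix x y
  have "cinner (?P *v x) y = cnj (cinner y (?P *v x))" by (rule cinner_commute)
  also have "\<dots> = cnj (cinner (?P *v y) (?P *v x))"
    by (simp add: orth_proj_orthogonal[OF assms orth_proj_mem[OF assms]])
  also have "\<dots> = cinner (?P *v x) (?P *v y)" by (rule cinner_commute[symmetric])
  also have "\<dots> = cinner x (?P *v y)"
    by (simp add: orth_proj_orthogonal[OF assms orth_proj_mem[OF assms]])
  finally show "cinner (?P *v x) y = cinner x (?P *v y)" .
qed

text \<open>Cyclicity of the trace moves both projections onto \<open>\<rho>\<close>. With
  \<open>x = e i\<close>, coordinate \<open>i\<close> of a point of the joint numerical range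
  becomes diagonal entry \<open>i\<close>, in the basis \<open>e\<close>, of the compression of
  \<open>\<rho>\<close> to \<open>S\<close>.\<close>

lemma trace_compressed_outer:
  assumes "vec.subspace S"
  shows "trace (orth_proj S ** outer x x ** orth_proj S ** \<rho>)
    = cinner ((orth_proj S ** \<rho> ** orth_proj S) *v x) x"
proof -
  let ?P = "orth_proj S"
  have "trace (?P ** outer x x ** ?P ** \<rho>) = trace ((?P ** \<rho>) ** (?P ** outer x x))"
    by (subst trace_mul_sym) (simp add: matrix_mul_assoc)
  also have "\<dots> = trace ((?P ** \<rho> ** ?P) ** outer x x)"
    by (simp add: matrix_mul_assoc)
  finally show ?thesis by (simp add: matrix_mult_outer trace_outer)
qed

text \<open>A density matrix with range in \<open>S\<close> has the same quadratic form as its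
  compression to \<open>S\<close>, so the matrix behind the moment point is also a witness
  here.\<close>

lemma moment_imp_joint_numerical_range:
  assumes S: "vec.subspace S" and x: "x \<in> moment e S"
  shows "(\<chi> i. complex_of_real (x $ i)) \<in>
    joint_numerical_range (\<lambda>i. orth_proj S ** outer (e i) (e i) ** orth_proj S)"
proof -
  let ?P = "orth_proj S"
  obtain \<rho> where \<rho>: "pos_semidef \<rho>" "trace \<rho> = 1" "\<And>v. \<rho> *v v \<in> S"
      "\<And>i. cinner (\<rho> *v e i) (e i) = complex_of_real (x $ i)"
    using moment_imp_density[OF S x] by blast
  have herm: "hermitian \<rho>" using \<rho>(1) by (simp add: pos_semidef_def)
  have "cinner ((?P ** \<rho> ** ?P) *v v) v = cinner (\<rho> *v v) v" for v
  proof -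
    have "cinner ((?P ** \<rho> ** ?P) *v v) v = cinner (?P *v (\<rho> *v (?P *v v))) v"
      by (simp add: matrix_vector_mul_assoc matrix_mul_assoc)
    also have "\<dots> = cinner (?P *v v) (\<rho> *v (?P *v v))"
      by (simp add: hermitian_cinner[OF hermitian_orth_proj[OF S]] hermitian_cinner[OF herm])
    also have "\<dots> = cinner v (\<rho> *v (?P *v v))"
      by (rule orth_proj_orthogonal[OF S \<rho>(3)])
    also have "\<dots> = cinner (?P *v (\<rho> *v v)) v"
      by (simp add: hermitian_cinner[OF hermitian_orth_proj[OF S]] hermitian_cinner[OF herm])
    also have "\<dots> = cnj (cinner (?P *v v) (\<rho> *v v))"
      by (metis cinner_commute hermitian_cinner[OF hermitian_orth_proj[OF S]])
    also have "\<dots> = cinner (\<rho> *v v) v"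
      by (simp add: orth_proj_orthogonal[OF S \<rho>(3)] flip: cinner_commute)
    finally show ?thesis .
  qed
  then show ?thesis
    unfolding joint_numerical_range_def using \<rho>(1,2,4)
    by (intro CollectI exI[of _ \<rho>]) (simp add: trace_compressed_outer[OF S])
qed

text \<open>The density matrix may live partly outside \<open>S\<close>, so its compression
  \<open>A\<close> need not have trace 1; the scalar \<open>c\<close> absorbs this. If
  \<open>c\<close> were 0, the nonnegative eigenvalues of \<open>A\<close> on \<open>S\<close> would
  all vanish, and \<open>y\<close> with them.\<close>

lemma joint_numerical_range_imp_moment:
  assumes S: "vec.subspace S" and "y \<noteq> 0"
    and y: "y \<in> joint_numerical_range (\<lambda>i. orth_proj S ** outer (e i) (e i) ** orth_proj S)"
  shows "\<exists>c x. c \<noteq> 0 \<and> x \<in> moment e S \<and> y = (\<chi> i. complex_of_real (c * x $ i))"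
proof -
  let ?P = "orth_proj S"
  obtain \<rho> where \<rho>: "pos_semidef \<rho>"
    and y: "y = (\<chi> i. trace (?P ** outer (e i) (e i) ** ?P ** \<rho>))"
    using y unfolding joint_numerical_range_def by blast
  define A where "A = ?P ** \<rho> ** ?P"
  note P = hermitian_cinner[OF hermitian_orth_proj[OF S]]
  have herm: "hermitian \<rho>" using \<rho> by (simp add: pos_semidef_def)
  have Av: "A *v v = ?P *v (\<rho> *v (?P *v v))" for v
    by (simp add: A_def matrix_vector_mul_assoc matrix_mul_assoc)
  have "hermitian A"
    by (rule hermitianI) (simp add: Av P hermitian_cinner[OF herm])
  moreover have "0 \<le> Re (cinner (A *v v) v)" for v
    using \<rho> unfolding Av P pos_semidef_def by blast
  ultimately have psd: "pos_semidef A" by (simp add: pos_semidef_def)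
  have ran: "A *v v \<in> S" for v unfolding Av by (rule orth_proj_mem[OF S])
  obtain r :: nat and s t where s: "is_onb {1..r} s S" and t: "\<forall>h\<in>{1..r}. 0 \<le> t h"
    and diag: "\<And>i. cinner (A *v e i) (e i) =
      complex_of_real ((\<Sum>h=1..r. t h *\<^sub>R sq_coords e (s h)) $ i)"
    using pos_semidef_spectral[OF S psd ran, of e] by blast
  define c where "c = (\<Sum>h=1..r. t h)"
  have yi: "y $ i = complex_of_real ((\<Sum>h=1..r. t h *\<^sub>R sq_coords e (s h)) $ i)" for i
    unfolding y vec_lambda_beta trace_compressed_outer[OF S] A_def[symmetric] by (rule diag)
  have "c \<noteq> 0"
  proof
    assume "c = 0"
    then have "\<forall>h\<in>{1..r}. t h = 0"
      using t unfolding c_def by (subst (asm) sum_nonneg_eq_0_iff) auto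
    then have "y = 0" by (simp add: vec_eq_iff yi)
    then show False using \<open>y \<noteq> 0\<close> by blast
  qed
  have "0 \<le> c" using t unfolding c_def by (intro sum_nonneg) auto
  have "(\<Sum>h=1..r. (t h / c) *\<^sub>R sq_coords e (s h)) \<in> moment e S"
    using s t \<open>c \<noteq> 0\<close> \<open>0 \<le> c\<close>
    by (intro onb_sum_in_moment) (auto simp: c_def simp flip: sum_divide_distrib)
  moreover have "y = (\<chi> i. complex_of_real (c * (\<Sum>h=1..r. (t h / c) *\<^sub>R sq_coords e (s h)) $ i))"
    unfolding vec_eq_iff using \<open>c \<noteq> 0\<close> by (simp add: yi sum_distrib_left)
  ultimately show ?thesis using \<open>c \<noteq> 0\<close> by blast
qed

lemma moments_meet_iff_joint_numerical_ranges_meet: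
  assumes e: "is_onb UNIV e UNIV" and S: "vec.subspace S" and T: "vec.subspace T"
  shows "moment e S \<inter> moment e T \<noteq> {} \<longleftrightarrow>
    (\<exists>x. x \<noteq> 0 \<and>
      x \<in> joint_numerical_range (\<lambda>i. orth_proj S ** outer (e i) (e i) ** orth_proj S) \<inter>
          joint_numerical_range (\<lambda>i. orth_proj T ** outer (e i) (e i) ** orth_proj T))"
    (is "?L \<longleftrightarrow> ?R")
proof
  assume ?L
  then obtain x where x: "x \<in> moment e S" "x \<in> moment e T" by blast
  let ?y = "\<chi> i. complex_of_real (x $ i)"
  have "x \<noteq> 0" using sum_moment_eq_1[OF e x(1)] by auto
  then have "?y \<noteq> 0" by (simp add: vec_eq_iff)
  then show ?R
    using moment_imp_joint_numerical_range[OF S x(1)] moment_imp_joint_numerical_range[OF T x(2)]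
    by blast
next
  assume ?R
  then obtain y where y: "y \<noteq> 0"
      "y \<in> joint_numerical_range (\<lambda>i. orth_proj S ** outer (e i) (e i) ** orth_proj S)"
      "y \<in> joint_numerical_range (\<lambda>i. orth_proj T ** outer (e i) (e i) ** orth_proj T)"
    by blast
  obtain c x where x: "c \<noteq> 0" "x \<in> moment e S" "y = (\<chi> i. complex_of_real (c * x $ i))"
    using joint_numerical_range_imp_moment[OF S y(1,2)] by blast
  obtain d z where z: "d \<noteq> 0" "z \<in> moment e T" "y = (\<chi> i. complex_of_real (d * z $ i))"
    using joint_numerical_range_imp_moment[OF T y(1,3)] by blast
  have eq: "c * x $ i = d * z $ i" for i
  proof -
    have "complex_of_real (c * x $ i) = complex_of_real (d * z $ i)"
      using x(3) z(3) by (metis vec_lambda_beta)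
    then show ?thesis by (simp only: of_real_eq_iff)
  qed
  \<comment> \<open>The two scalars came from different compressions; summing the coordinates, which
    add up to 1 on both moments, shows that they agree.\<close>
  have "c * (\<Sum>i\<in>UNIV. x $ i) = d * (\<Sum>i\<in>UNIV. z $ i)"
    by (simp only: sum_distrib_left eq)
  then have "c = d" using sum_moment_eq_1[OF e x(2)] sum_moment_eq_1[OF e z(2)] by simp
  then have "x = z" using eq \<open>c \<noteq> 0\<close> by (simp add: vec_eq_iff)
  then show ?L using x(2) z(2) by blast
qed

subsection \<open>Minimality and moments\<close>

lemma norm_matrix_vector_le: "norm (A *v v) \<le> spectral_norm A * norm v"
  unfolding spectral_norm_def by (rule onorm) simp

lemma abs_quadratic_le:
  assumes "norm v = 1"
  shows "\<bar>(A *v v) \<bullet> v\<bar> \<le> spectral_norm A"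
  using Cauchy_Schwarz_ineq2[of "A *v v" v] norm_matrix_vector_le[of A v] assms by simp

text \<open>Polarization: \<open>4 (A x \<bullet> y)\<close> is a difference of two values of the quadratic form.\<close>

lemma hermitian_spectral_norm_le:
  fixes A :: "complex^'n^'n"
  assumes A: "hermitian A" and bound: "\<And>v. norm v = 1 \<Longrightarrow> \<bar>(A *v v) \<bullet> v\<bar> \<le> c"
  shows "spectral_norm A \<le> c"
proof -
  have quad: "\<bar>(A *v v) \<bullet> v\<bar> \<le> c * (norm v)\<^sup>2" for v
  proof (cases "v = 0")
    case False
    have "\<bar>(A *v ((1 / norm v) *\<^sub>R v)) \<bullet> ((1 / norm v) *\<^sub>R v)\<bar> \<le> c"
      by (rule bound) (use False in simp)
    then show ?thesis
      using False
      by (simp add: matrix_vector_mult_scaleR_complex abs_mult field_simps power2_eq_square)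
  qed simp
  have pol: "2 * ((A *v x) \<bullet> y) \<le> c * ((norm x)\<^sup>2 + (norm y)\<^sup>2)" for x y
  proof -
    have "(A *v y) \<bullet> x = (A *v x) \<bullet> y"
      using hermitian_inner[OF A, of y x] by (simp add: inner_commute)
    then have "4 * ((A *v x) \<bullet> y) = (A *v (x + y)) \<bullet> (x + y) - (A *v (x - y)) \<bullet> (x - y)"
      by (simp add: matrix_vector_right_distrib matrix_vector_mult_diff_distrib
          inner_add_left inner_add_right inner_diff_left inner_diff_right)
    also have "\<dots> \<le> c * (norm (x + y))\<^sup>2 + c * (norm (x - y))\<^sup>2"
      using quad[of "x + y"] quad[of "x - y"] by linarith
    also have "\<dots> = 2 * (c * ((norm x)\<^sup>2 + (norm y)\<^sup>2))"
      by (simp add: power2_norm_eq_inner inner_add_left inner_add_right inner_diff_left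
          inner_diff_right algebra_simps)
    finally show ?thesis by simp
  qed
  show ?thesis
    unfolding spectral_norm_def
  proof (rule onorm_le)
    fix x
    show "norm (A *v x) \<le> c * norm x"
    proof (cases "A *v x = 0 \<or> x = 0")
      case True
      \<comment> \<open>Any unit vector would do: \<open>c\<close> bounds an absolute value.\<close>
      have "0 \<le> c" using bound[of "axis undefined 1"] by (simp add: norm_axis_1)
      then show ?thesis using True by auto
    next
      case False
      then have pos: "0 < norm (A *v x)" "0 < norm x" by auto
      \<comment> \<open>The vector of norm \<open>norm x\<close> in the direction of
        \<open>A *v x\<close>, which makes both sides of \<open>pol\<close> comparable to
        \<open>norm x\<close>.\<close>
      define y where "y = (norm x / norm (A *v x)) *\<^sub>R (A *v x)"
      have "norm y = norm x" using pos by (simp add: y_def)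
      moreover have "(A *v x) \<bullet> y = norm x * norm (A *v x)"
        using pos by (simp add: y_def dot_square_norm power2_eq_square)
      ultimately have "2 * (norm x * norm (A *v x)) \<le> 2 * (norm x * (c * norm x))"
        using pol[of x y] by (simp add: power2_eq_square algebra_simps)
      then show ?thesis using pos by simp
    qed
  qed
qed

section \<open>Diagonal perturbations and the spectral norm\<close>

lemma sum_matrix_vector_mult: "(\<Sum>i\<in>I. f i) *v v = (\<Sum>i\<in>I. f i *v v)"
  by (induction I rule: infinite_finite_induct) (simp_all add: matrix_vector_mult_add_rdistrib)

text \<open>\<open>D *v e j\<close> is orthogonal to every other basis vector, so \<open>D\<close>
  multiplies the \<open>e i\<close> coordinate of \<open>v\<close> by a diagonal entry.
  \<open>D\<close> may have a complex diagonal; the real inner product keeps its real part, and the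
  form becomes linear in \<open>sq_coords e v\<close>.\<close>

lemma diagonal_in_quadratic:
  assumes e: "is_onb UNIV e UNIV" and D: "diagonal_in e D"
  shows "(D *v v) \<bullet> v = (\<chi> i. (D *v e i) \<bullet> e i) \<bullet> sq_coords e v"
proof -
  have D_e: "cinner (D *v v) (e i) = cinner v (e i) * cinner (D *v e i) (e i)" for i
  proof -
    have "D *v v = (\<Sum>j\<in>UNIV. cinner v (e j) *s (D *v e j))"
      by (subst is_onb_expansion[OF e, of v])
        (simp_all add: linear_sum[OF matrix_vector_mul_linear] vector_scalar_commute)
    then have "cinner (D *v v) (e i)
        = (\<Sum>j\<in>UNIV. cinner v (e j) * cinner (D *v e j) (e i))"
      by (simp add: cinner_sum_left cinner_scale_left)
    also have "\<dots> = (\<Sum>j\<in>UNIV. if j = i then cinner v (e j) * cinner (D *v e j) (e i) else 0)"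
      using D by (intro sum.cong) (auto simp: diagonal_in_def)
    finally show ?thesis by simp
  qed
  have "cinner (D *v v) v = (\<Sum>i\<in>UNIV. cinner (D *v v) (e i) * cinner (e i) v)"
    by (rule is_onb_cinner_expansion[OF e]) auto
  also have "\<dots> = (\<Sum>i\<in>UNIV. cinner (D *v e i) (e i) * complex_of_real (sq_coords e v $ i))"
    unfolding D_e
    by (simp add: sq_coords_def mult_ac flip: cinner_mult_commute of_real_power)
  finally show ?thesis
    by (simp add: inner_eq_Re_cinner inner_vec_def)
qed

lemma moments_meet_imp_minimal:
  assumes e: "is_onb UNIV e UNIV" and M: "hermitian M"
    and meet: "moment e (eigenspace M (complex_of_real (spectral_norm M))) \<inter>
      moment e (eigenspace M (complex_of_real (- spectral_norm M))) \<noteq> {}"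
  shows "minimal_matrix e M"
  unfolding minimal_matrix_def
proof (intro conjI M allI impI)
  fix D assume D: "diagonal_in e D"
  let ?N = "spectral_norm M" and ?K = "spectral_norm (M + D)"
  define d where "d = (\<chi> i. (D *v e i) \<bullet> e i)"
  have quad: "\<bar>c + d \<bullet> sq_coords e v\<bar> \<le> ?K"
    if "v \<in> eigenspace M (complex_of_real c)" "norm v = 1" for v c
  proof -
    have "(M *v v) \<bullet> v = c"
      using that by (simp add: eigenspace_def dot_square_norm flip: scaleR_eq_smult)
    moreover have "(D *v v) \<bullet> v = d \<bullet> sq_coords e v"
      unfolding d_def by (rule diagonal_in_quadratic[OF e D])
    ultimately have "((M + D) *v v) \<bullet> v = c + d \<bullet> sq_coords e v"
      by (simp add: matrix_vector_mult_add_rdistrib inner_add_left)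
    then show ?thesis using abs_quadratic_le[OF that(2), of "M + D"] by simp
  qed
  \<comment> \<open>Halfspaces are convex, so a bound on unit eigenvectors passes to the moments; a
    point in both halfspaces forces \<open>?N \<le> ?K\<close>.\<close>
  have "moment e (eigenspace M (complex_of_real ?N)) \<subseteq> {x. d \<bullet> x \<le> ?K - ?N}"
    unfolding moment_def using quad[of _ ?N]
    by (intro hull_minimal convex_halfspace_le) fastforce
  moreover have "moment e (eigenspace M (complex_of_real (- ?N))) \<subseteq> {x. d \<bullet> x \<ge> ?N - ?K}"
    unfolding moment_def using quad[of _ "- ?N"]
    by (intro hull_minimal convex_halfspace_ge) fastforce
  ultimately show "?N \<le> ?K" using meet by fastforce
qed

text \<open>Where \<open>g\<close> is negative, every positive \<epsilon> works. The rest
  \<open>K'\<close> is compact and \<open>f\<close> stays below \<open>c\<close> on it, so there is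
  a uniform gap \<eta>; with \<open>g\<close> bounded by \<open>B\<close>, any \<epsilon> below
  \<open>\<eta> / B\<close> does not use it up.\<close>

lemma compact_perturbation_less:
  fixes f g :: "'a::t2_space \<Rightarrow> real"
  assumes K: "compact K" and f: "continuous_on K f" and g: "continuous_on K g"
    and le: "\<And>v. v \<in> K \<Longrightarrow> f v \<le> c" and less: "\<And>v. v \<in> K \<Longrightarrow> f v = c \<Longrightarrow> g v < 0"
  shows "\<exists>\<epsilon>0>0. \<forall>\<epsilon>. 0 < \<epsilon> \<and> \<epsilon> < \<epsilon>0 \<longrightarrow> (\<forall>v\<in>K. f v + \<epsilon> * g v < c)"
proof -
  define K' where "K' = {v \<in> K. 0 \<le> g v}"
  have "K' = K \<inter> g -` {0..}" by (auto simp: K'_def)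
  moreover have "closed (K \<inter> g -` {0..})"
    by (rule continuous_closed_preimage[OF g compact_imp_closed[OF K]]) simp
  ultimately have "compact K'"
    using K closed_Int_compact[of K' K] by (simp add: Int_absorb2 Int_commute)
  have "bounded (g ` K)" using K g by (intro compact_imp_bounded compact_continuous_image)
  then obtain B where B: "B > 0" "\<And>v. v \<in> K \<Longrightarrow> g v \<le> B"
    unfolding bounded_pos by (fastforce simp: abs_le_iff)
  obtain \<eta> where \<eta>: "\<eta> > 0" "\<And>v. v \<in> K' \<Longrightarrow> f v \<le> c - \<eta>"
  proof (cases "K' = {}")
    case False
    have "continuous_on K' f" using f by (rule continuous_on_subset) (auto simp: K'_def)
    then obtain v where v: "v \<in> K'" "\<And>w. w \<in> K' \<Longrightarrow> f w \<le> f v"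
      using continuous_attains_sup[OF \<open>compact K'\<close> False] by blast
    then have "f v < c" using le[of v] less[of v] by (force simp: K'_def)
    then show ?thesis using v(2) by (intro that[of "c - f v"]) auto
  qed (use that[of 1] in auto)
  show ?thesis
  proof (intro exI[of _ "\<eta> / B"] conjI allI impI ballI)
    show "0 < \<eta> / B" using \<eta> B by simp
    fix \<epsilon> v assume \<epsilon>: "0 < \<epsilon> \<and> \<epsilon> < \<eta> / B" and v: "v \<in> K"
    show "f v + \<epsilon> * g v < c"
    proof (cases "0 \<le> g v")
      case True
      have "\<epsilon> * g v \<le> \<epsilon> * B" using \<epsilon> B(2)[OF v] by simp
      also have "\<dots> < \<eta>" using \<epsilon> B(1) by (simp add: field_simps)
      finally show ?thesis using \<eta>(2)[of v] True v by (simp add: K'_def)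
    next
      case False
      then have "\<epsilon> * g v < 0" using \<epsilon> by (simp add: mult_pos_neg)
      then show ?thesis using le[OF v] by simp
    qed
  qed
qed

text \<open>Equality case of Cauchy-Schwarz: the squared norm of
  \<open>M *v v - c *\<^sub>R v\<close> is that of \<open>M *v v\<close> minus \<open>c\<close>
  squared, hence at most 0. The condition on squares covers both signs of \<open>c\<close>.\<close>

lemma quadratic_eq_norm_imp_eigenspace:
  assumes v: "norm v = 1" and eq: "(M *v v) \<bullet> v = c" and c: "c\<^sup>2 = (spectral_norm M)\<^sup>2"
  shows "v \<in> eigenspace M (complex_of_real c)"
proof -
  have "norm (M *v v) \<le> spectral_norm M" using norm_matrix_vector_le[of M v] v by simp
  then have "(norm (M *v v))\<^sup>2 \<le> c\<^sup>2" unfolding c by (intro power_mono) auto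
  moreover have "(norm (M *v v - c *\<^sub>R v))\<^sup>2 = (norm (M *v v))\<^sup>2 - 2 * c * c + c\<^sup>2"
    using v eq unfolding power2_norm_eq_inner
    by (simp add: inner_diff_left inner_diff_right inner_commute
        algebra_simps norm_eq_1 power2_eq_square)
  ultimately have "(norm (M *v v - c *\<^sub>R v))\<^sup>2 \<le> 0" by (simp add: power2_eq_square)
  then show ?thesis by (simp add: eigenspace_def scaleR_eq_smult)
qed

lemma vec_subspace_eigenspace: "vec.subspace (eigenspace A c)"
  by (auto simp: vec.subspace_def eigenspace_def matrix_vector_right_distrib vector_scalar_commute
      vector_smult_assoc mult.commute vec.scale_right_distrib)

lemma compact_moment:
  assumes "vec.subspace S"
  shows "compact (moment e S)"
  unfolding moment_def sq_coords_def cinner_def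
  by (intro compact_convex_hull compact_continuous_image compact_unit_sphere_subspace assms
      continuous_intros)

lemma minimal_imp_moments_meet:
  fixes e :: "'n::finite \<Rightarrow> complex^'n"
  assumes e: "is_onb UNIV e UNIV" and min: "minimal_matrix e M"
  shows "moment e (eigenspace M (complex_of_real (spectral_norm M))) \<inter>
    moment e (eigenspace M (complex_of_real (- spectral_norm M))) \<noteq> {}"
proof
  let ?N = "spectral_norm M"
  let ?V = "eigenspace M (complex_of_real ?N)" and ?W = "eigenspace M (complex_of_real (- ?N))"
  let ?K = "{v :: complex^'n. norm v = 1}"
  assume disj: "moment e ?V \<inter> moment e ?W = {}"
  have "\<exists>a b. (\<forall>x\<in>moment e ?V. a \<bullet> x < b) \<and> (\<forall>x\<in>moment e ?W. a \<bullet> x > b)"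
  proof (cases "moment e ?W = {}")
    case True
    \<comment> \<open>The separation theorem wants a nonempty compact set. If the second moment is
      empty, \<open>a = 0\<close> and \<open>b = 1\<close> satisfy the first inequality, the second
      being vacuous.\<close>
    then show ?thesis by (intro exI[of _ 0] exI[of _ 1]) simp
  next
    case False
    then show ?thesis
      using disj
      by (intro separating_hyperplane_closed_compact compact_imp_closed compact_moment
          vec_subspace_eigenspace) (auto simp: moment_def)
  qed
  then obtain a b where a: "\<And>x. x \<in> moment e ?V \<Longrightarrow> a \<bullet> x < b" "\<And>x. x \<in> moment e ?W \<Longrightarrow> a \<bullet> x > b"
    by blast
  \<comment> \<open>Shifting by \<open>b\<close> turns the affine separation into a sign: by
    Parseval the form of \<open>D\<close> at a unit vector is
    \<open>a \<bullet> sq_coords e v - b\<close>.\<close>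
  define D where "D = (\<Sum>i\<in>UNIV. (a $ i - b) *\<^sub>R outer (e i) (e i))"
  define q where "q v = (D *v v) \<bullet> v" for v
  have D_mult: "D *v v = (\<Sum>i\<in>UNIV. complex_of_real (a $ i - b) *s (cinner v (e i) *s e i))" for v
    unfolding D_def sum_matrix_vector_mult scaleR_matrix_vector_mult scaleR_eq_smult
      outer_mult_vector ..
  have herm: "hermitian M" using min by (simp add: minimal_matrix_def)
  have "hermitian D"
    by (rule hermitianI) (simp add: D_mult cinner_sum_left cinner_sum_right cinner_scale_left
        cinner_scale_right mult_ac flip: cinner_commute)
  have D_e: "cinner (D *v e j) (e i) = (if i = j then complex_of_real (a $ i - b) else 0)" for i j
  proof -
    have "cinner (D *v e j) (e i)
        = (\<Sum>k\<in>UNIV. if k = i then (if i = j then complex_of_real (a $ i - b) else 0) else 0)"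
      unfolding D_mult cinner_sum_left cinner_scale_left
      using e by (intro sum.cong) (auto simp: is_onb_def)
    then show ?thesis by simp
  qed
  have diag: "diagonal_in e (\<epsilon> *\<^sub>R D)" for \<epsilon>
    by (simp add: diagonal_in_def scaleR_matrix_vector_mult scaleR_eq_smult cinner_scale_left D_e)
  have q: "q v = a \<bullet> sq_coords e v - b * (norm v)\<^sup>2" for v
  proof -
    have "q v = (\<chi> i. a $ i - b) \<bullet> sq_coords e v"
      using diagonal_in_quadratic[OF e, of D v] diag[of 1]
      by (simp add: q_def inner_eq_Re_cinner[of "D *v _" "e _"] D_e)
    then show ?thesis
      by (simp add: inner_vec_def left_diff_distrib sum_subtractf sum_sq_coords[OF e, of v]
          flip: sum_distrib_left)
  qed
  have "compact ?K" using compact_sphere[of 0 1] by (simp add: sphere_def)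
  have cont: "continuous_on ?K (\<lambda>v. (A *v v) \<bullet> v)" for A :: "complex^'n^'n"
    by (intro continuous_intros)
  have mom: "sq_coords e v \<in> moment e S" if "v \<in> S" "norm v = 1" for v S
    unfolding moment_def using that by (intro hull_inc) auto
  \<comment> \<open>A unit vector where the form of \<open>M\<close> reaches an extreme value is an
    eigenvector, so its \<open>sq_coords\<close> lie in a moment and the separation gives the sign
    of \<open>q\<close>.\<close>
  have less: "q v < 0" if "v \<in> ?K" "(M *v v) \<bullet> v = ?N" for v
    using that a(1)[OF mom[OF quadratic_eq_norm_imp_eigenspace[of v M ?N]]] by (simp add: q)
  have greater: "0 < q v" if "v \<in> ?K" "(M *v v) \<bullet> v = - ?N" for v
    using that a(2)[OF mom[OF quadratic_eq_norm_imp_eigenspace[of v M "- ?N"]]] by (simp add: q)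
  have bound: "\<bar>(M *v v) \<bullet> v\<bar> \<le> ?N" if "v \<in> ?K" for v using that abs_quadratic_le by blast
  have "\<exists>\<epsilon>0>0. \<forall>\<epsilon>. 0 < \<epsilon> \<and> \<epsilon> < \<epsilon>0 \<longrightarrow> (\<forall>v\<in>?K. (M *v v) \<bullet> v + \<epsilon> * q v < ?N)"
    using bound less unfolding q_def
    by (intro compact_perturbation_less cont \<open>compact ?K\<close>) (auto simp: abs_le_iff)
  then obtain \<epsilon>1 where \<epsilon>1: "\<epsilon>1 > 0"
      "\<And>\<epsilon> v. 0 < \<epsilon> \<Longrightarrow> \<epsilon> < \<epsilon>1 \<Longrightarrow> v \<in> ?K \<Longrightarrow> (M *v v) \<bullet> v + \<epsilon> * q v < ?N"
    by blast
  \<comment> \<open>The same perturbation argument for the negated forms bounds the perturbed form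
    from below.\<close>
  have "\<exists>\<epsilon>0>0. \<forall>\<epsilon>. 0 < \<epsilon> \<and> \<epsilon> < \<epsilon>0 \<longrightarrow> (\<forall>v\<in>?K. - ((M *v v) \<bullet> v) + \<epsilon> * (- q v) < ?N)"
    using bound greater unfolding q_def
    by (intro compact_perturbation_less continuous_on_minus cont \<open>compact ?K\<close>)
      (force simp: abs_le_iff)+
  then obtain \<epsilon>2 where \<epsilon>2: "\<epsilon>2 > 0"
      "\<And>\<epsilon> v. 0 < \<epsilon> \<Longrightarrow> \<epsilon> < \<epsilon>2 \<Longrightarrow> v \<in> ?K \<Longrightarrow> - ((M *v v) \<bullet> v) + \<epsilon> * (- q v) < ?N"
    by blast
  define \<epsilon> where "\<epsilon> = min \<epsilon>1 \<epsilon>2 / 2"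
  have \<epsilon>: "0 < \<epsilon>" "\<epsilon> < \<epsilon>1" "\<epsilon> < \<epsilon>2" using \<epsilon>1(1) \<epsilon>2(1) by (auto simp: \<epsilon>_def)
  let ?A = "M + \<epsilon> *\<^sub>R D"
  have A: "(?A *v v) \<bullet> v = (M *v v) \<bullet> v + \<epsilon> * q v" for v
    by (simp add: matrix_vector_mult_add_rdistrib scaleR_matrix_vector_mult inner_add_left q_def)
  \<comment> \<open>The maximum over the unit sphere is attained, so the pointwise strict bound
    becomes a strict bound on the spectral norm.\<close>
  have "axis undefined 1 \<in> ?K" by (simp add: norm_axis_1)
  then have "?K \<noteq> {}" by blast
  moreover have "continuous_on ?K (\<lambda>v. \<bar>(?A *v v) \<bullet> v\<bar>)" by (intro continuous_on_rabs cont)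
  ultimately obtain u where u: "u \<in> ?K" "\<And>v. v \<in> ?K \<Longrightarrow> \<bar>(?A *v v) \<bullet> v\<bar> \<le> \<bar>(?A *v u) \<bullet> u\<bar>"
    using continuous_attains_sup[OF \<open>compact ?K\<close>] by blast
  have "spectral_norm ?A \<le> \<bar>(?A *v u) \<bullet> u\<bar>"
    using u(2) by (intro hermitian_spectral_norm_le hermitian_add herm hermitian_scaleR \<open>hermitian D\<close>) auto
  also have "\<dots> < ?N"
    using \<epsilon>1(2)[OF \<epsilon>(1,2) u(1)] \<epsilon>2(2)[OF \<epsilon>(1,3) u(1)] unfolding A by (simp add: abs_less_iff)
  also have "?N \<le> spectral_norm ?A" using min diag unfolding minimal_matrix_def by blast
  finally show False by simp
qed

section \<open>Orthogonality of the eigenspaces and the equivalences\<close>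

lemma eigenspaces_orthogonal:
  assumes M: "hermitian M" and "b \<noteq> c"
    and x: "x \<in> eigenspace M (complex_of_real b)" and y: "y \<in> eigenspace M (complex_of_real c)"
  shows "cinner x y = 0"
proof -
  have "complex_of_real b * cinner x y = complex_of_real c * cinner x y"
    using hermitian_cinner[OF M, of x y] x y
    by (simp add: eigenspace_def cinner_scale_left cinner_scale_right)
  then show ?thesis using \<open>b \<noteq> c\<close> by simp
qed

lemma spectral_norm_eq_0_iff: "spectral_norm M = 0 \<longleftrightarrow> M = 0"
  unfolding spectral_norm_def by (simp add: onorm_eq_0 matrix_eq)

theorem corollary6p8:
  fixes e :: "'n::finite \<Rightarrow> complex^'n"
    and M :: "complex^'n^'n"
    and \<V> \<W> :: "(complex^'n) set"
  assumes "is_onb UNIV e UNIV"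
    and "M \<noteq> 0"
    and "hermitian M"
    and "spectral_norm M = lambda_max M"
    and "lambda_max M = - lambda_min M"
    and "\<V> = eigenspace M (complex_of_real (spectral_norm M))"
    and "\<W> = eigenspace M (complex_of_real (- spectral_norm M))"
  shows "(is_support e \<V> \<W> \<longleftrightarrow> moment e \<V> \<inter> moment e \<W> \<noteq> {})
    \<and> (moment e \<V> \<inter> moment e \<W> \<noteq> {} \<longleftrightarrow> minimal_matrix e M)
    \<and> (minimal_matrix e M \<longleftrightarrow>
        (\<exists>x. x \<noteq> 0 \<and>
          x \<in> joint_numerical_range
                (\<lambda>i. orth_proj \<V> ** outer (e i) (e i) ** orth_proj \<V>) \<inter>
              joint_numerical_range
                (\<lambda>i. orth_proj \<W> ** outer (e i) (e i) ** orth_proj \<W>)))"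
proof -
  have sub: "vec.subspace \<V>" "vec.subspace \<W>"
    unfolding assms(6,7) by (rule vec_subspace_eigenspace)+
  \<comment> \<open>Since \<open>M\<close> is nonzero the two eigenvalues differ, which gives the
    orthogonality that a support demands.\<close>
  have "spectral_norm M \<noteq> - spectral_norm M"
    using \<open>M \<noteq> 0\<close> spectral_norm_eq_0_iff[of M] by simp
  then have "\<forall>x\<in>\<V>. \<forall>y\<in>\<W>. cinner x y = 0"
    unfolding assms(6,7) using eigenspaces_orthogonal[OF assms(3)] by blast
  then have "is_support e \<V> \<W> \<longleftrightarrow> moment e \<V> \<inter> moment e \<W> \<noteq> {}"
    by (rule is_support_iff_moments_meet[OF sub])
  moreover have "moment e \<V> \<inter> moment e \<W> \<noteq> {} \<longleftrightarrow> minimal_matrix e M"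
    unfolding assms(6,7)
    using moments_meet_imp_minimal[OF assms(1,3)] minimal_imp_moments_meet[OF assms(1)] by blast
  ultimately show ?thesis
    using moments_meet_iff_joint_numerical_ranges_meet[OF assms(1) sub] by blast
qed

end
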